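(* Let $l\geq 1$ and let $m_1,\dots,m_l$ be positive integers (not necessarily distinct and not necessarily in non-decreasing order). Let $\theta(m_1^{[2]},\dots,m_l^{[2]})$ be the bridge graph consisting of $2l$ internally disjoint $(u,v)$-paths, exactly two of length $m_i$ for each $i=1,\dots,l$ (counted with multiplicity). Then $\chi_{la}(\theta(m_1^{[2]},\dots,m_l^{[2]}))\le 3$.
   Context: For a connected graph $G=(V,E)$, a local antimagic labeling is a bijection $f:E\to\{1,\dots,|E|\}$ such that $f^+(x)\neq f^+(y)$ for every pair of adjacent vertices $x,y$, where $f^+(x)=\sum_{e\ni x} f(e)$. The number of distinct values of $f^+$ is the color number $c(f)$, and $\chi_{la}(G)$ is the minimum of $c(f)$ over all local antimagic labelings $f$ of $G$. A bridge graph $\theta(a_1,\dots,a_s)$ consists of two vertices $u,v$ joined by $s$ internally disjoint (edge-disjoint) $(u,v)$-paths of lengths $a_1,\dots,a_s$. The notation $a^{[n]}$ denotes $n$ entries equal to $a$.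
   Formalization: Graphs are simple, so the result concerns all m_i ≥ 2; for m_i = 1 two disjoint paths of length 1 would be parallel edges, and allowing these makes the claim false (for l = 1, m_1 = 1 one gets f^+(u) = f^+(v) with u, v adjacent). *)

theory Defs
  imports Main "HOL-Library.Extended_Nat"
begin

definition simple_graph :: "'a set \<Rightarrow> 'a set set \<Rightarrow> bool" where
  "simple_graph V E \<longleftrightarrow> finite V \<and> (\<forall>e\<in>E. e \<subseteq> V \<and> card e = 2)"

definition vertex_sum :: "'a set set \<Rightarrow> ('a set \<Rightarrow> nat) \<Rightarrow> 'a \<Rightarrow> nat" where
  "vertex_sum E f x = (\<Sum>e\<in>{e\<in>E. x \<in> e}. f e)"

definition local_antimagic_labeling :: "'a set set \<Rightarrow> ('a set \<Rightarrow> nat) \<Rightarrow> bool" where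
  "local_antimagic_labeling E f \<longleftrightarrow>
     bij_betw f E {1..card E} \<and>
     (\<forall>x y. {x, y} \<in> E \<longrightarrow> vertex_sum E f x \<noteq> vertex_sum E f y)"

definition color_number :: "'a set \<Rightarrow> 'a set set \<Rightarrow> ('a set \<Rightarrow> nat) \<Rightarrow> nat" where
  "color_number V E f = card (vertex_sum E f ` V)"

text \<open>The value is \<open>\<infinity>\<close> if the graph has no local antimagic labeling, so a finite upper bound
  asserts in particular that such a labeling exists.\<close>

definition chi_la :: "'a set \<Rightarrow> 'a set set \<Rightarrow> enat" where
  "chi_la V E = (INF f\<in>{f. local_antimagic_labeling E f}. enat (color_number V E f))"

definition path_edges :: "'a list \<Rightarrow> 'a set set" where
  "path_edges p = {{p ! i, p ! Suc i} | i. Suc i < length p}"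

text \<open>A path is the list of its vertices; its length is the number of its edges.\<close>

definition is_path :: "'a set \<Rightarrow> 'a set set \<Rightarrow> 'a \<Rightarrow> 'a \<Rightarrow> 'a list \<Rightarrow> bool" where
  "is_path V E u v p \<longleftrightarrow>
     p \<noteq> [] \<and> hd p = u \<and> last p = v \<and> distinct p \<and> set p \<subseteq> V \<and> path_edges p \<subseteq> E"

text \<open>\<open>bridge_graph V E as\<close>: the graph \<open>(V, E)\<close> is a \<open>\<theta>(a\<^sub>1, \<dots>, a\<^sub>s)\<close> for the list \<open>as\<close> of the
  \<open>a\<^sub>i\<close>. Graphs being simple, edge-disjointness means that at most one \<open>a\<^sub>i\<close> can be \<open>1\<close>.
  Connectedness is automatic.\<close>

definition bridge_graph :: "'a set \<Rightarrow> 'a set set \<Rightarrow> nat list \<Rightarrow> bool" where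
  "bridge_graph V E as \<longleftrightarrow>
     simple_graph V E \<and>
     (\<exists>u v ps. u \<noteq> v \<and> length ps = length as \<and>
        (\<forall>i<length as. is_path V E u v (ps ! i) \<and> length (ps ! i) = as ! i + 1) \<and>
        (\<forall>i<length as. \<forall>j<length as. i \<noteq> j \<longrightarrow>
            set (ps ! i) \<inter> set (ps ! j) = {u, v} \<and>
            path_edges (ps ! i) \<inter> path_edges (ps ! j) = {}) \<and>
        V = {u, v} \<union> (\<Union>p\<in>set ps. set p) \<and>
        E = (\<Union>p\<in>set ps. path_edges p))"

end

theory Submission
  imports Defs
begin

text \<open>Let \<open>M\<close> be the number of edges and call \<open>t\<close> and \<open>M + 1 - t\<close> complementary labels. The
  complementary label pairs are split into \<open>l\<close> blocks of consecutive pairs, one block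
  \<open>s + 1, \<dots>, s + m\<^sub>i\<close> for each pair of twin paths of length \<open>m\<^sub>i\<close>. The first twin is labeled
  \<open>s + 1, M + 1 - (s + 2), s + 3, \<dots>\<close> from \<open>u\<close> to \<open>v\<close>, and the second twin gets the complementary
  labels. The sums at the inner vertices then alternate between \<open>M\<close> and \<open>M + 2\<close>, and each pair of
  twins contributes \<open>M + 1\<close> to \<open>u\<close> and to \<open>v\<close>, so both of these have sum \<open>l (M + 1)\<close>.\<close>

section \<open>Repeated list entries and consecutive blocks\<close>

lemma length_concat_map_replicate:
  "length (concat (map (replicate n) xs)) = n * length xs"
  by (induction xs) auto

lemma nth_concat_map_replicate:
  assumes "p < n * length xs"
  shows "concat (map (replicate n) xs) ! p = xs ! (p div n)"
  using assms
proof (induction xs arbitrary: p)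
  case (Cons x xs)
  show ?case
  proof (cases "p < n")
    case False
    then have "p div n = Suc ((p - n) div n)"
      using Cons.prems by (cases "n = 0") (simp_all add: le_div_geq)
    with False Cons show ?thesis
      by (simp add: nth_append)
  qed (simp add: nth_append)
qed simp

lemma sum_lessThan_double:
  "(\<Sum>p<2 * n. g p) = (\<Sum>i<n. g (2 * i) + g (2 * i + 1 :: nat))" for g :: "nat \<Rightarrow> 'b::comm_monoid_add"
  by (induction n) (simp_all add: add.assoc)

lemma exists_block:
  fixes m :: "nat \<Rightarrow> nat"
  assumes "t < (\<Sum>k<n. m k)"
  shows "\<exists>i<n. \<exists>j<m i. t = (\<Sum>k<i. m k) + j"
  using assms
proof (induction n)
  case (Suc n)
  show ?case
  proof (cases "t < (\<Sum>k<n. m k)")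
    case True
    with Suc.IH show ?thesis
      using less_SucI by blast
  next
    case False
    with Suc.prems show ?thesis
      by (intro exI[of _ n] conjI exI[of _ "t - (\<Sum>k<n. m k)"]) auto
  qed
qed simp

text \<open>In the locale, \<open>w p k\<close> is the \<open>k\<close>-th vertex of the \<open>p\<close>-th path; the twins are the paths
  \<open>2 i\<close> and \<open>2 i + 1\<close>.\<close>

locale twin_paths =
  fixes ms :: "nat list" and w :: "nat \<Rightarrow> nat \<Rightarrow> 'a" and u v :: 'a
  assumes ms_nonempty: "ms \<noteq> []"
    and two_le: "i < length ms \<Longrightarrow> 2 \<le> ms ! i"
    and w_first: "p < 2 * length ms \<Longrightarrow> w p 0 = u"
    and w_last: "p < 2 * length ms \<Longrightarrow> w p (ms ! (p div 2)) = v"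
    and w_eqD: "\<lbrakk>p < 2 * length ms; q < 2 * length ms; k \<le> ms ! (p div 2); k' \<le> ms ! (q div 2);
          w p k = w q k'\<rbrakk>
        \<Longrightarrow> k = 0 \<and> k' = 0 \<or> k = ms ! (p div 2) \<and> k' = ms ! (q div 2) \<or> p = q \<and> k = k'"
begin

section \<open>Edge indices and the labeling\<close>

definition I :: "(nat \<times> nat) set" where
  "I = Sigma {..<2 * length ms} (\<lambda>p. {..<ms ! (p div 2)})"

definition edge :: "nat \<times> nat \<Rightarrow> 'a set" where
  "edge = (\<lambda>(p, j). {w p j, w p (Suc j)})"

definition offset :: "nat \<Rightarrow> nat" where
  "offset i = (\<Sum>k<i. ms ! k)"

definition M :: nat where
  "M = 2 * offset (length ms)"

text \<open>The labeling on indices, where parities are visible: that of \<open>p + j\<close> flips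
  both along a path and between twins, which gives the alternation and the complementary labels at
  once.\<close>

definition h :: "nat \<times> nat \<Rightarrow> nat" where
  "h = (\<lambda>(p, j). let t = offset (p div 2) + j + 1 in if even (p + j) then t else M + 1 - t)"

definition f :: "'a set \<Rightarrow> nat" where
  "f e = h (inv_into I edge e)"

abbreviation E :: "'a set set" where
  "E \<equiv> edge ` I"

section \<open>Indexing of the edges and bijectivity of the labeling\<close>

lemma two_le': "p < 2 * length ms \<Longrightarrow> 2 \<le> ms ! (p div 2)"
  by (rule two_le) auto

lemma finite_I: "finite I"
  by (simp add: I_def)

lemma card_I: "card I = M"
proof -
  have "card I = (\<Sum>p<2 * length ms. ms ! (p div 2))"
    by (simp add: I_def)
  also have "\<dots> = (\<Sum>i<length ms. 2 * ms ! i)"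
    unfolding sum_lessThan_double by (intro sum.cong) auto
  finally show ?thesis
    by (simp add: M_def offset_def sum_distrib_left)
qed

text \<open>On a path of length at least 2 every edge has an inner endpoint, and an inner vertex
  determines its path and its position.\<close>

lemma inj_on_edge: "inj_on edge I"
proof (rule inj_onI, clarify)
  fix p j q k
  assume I: "(p, j) \<in> I" "(q, k) \<in> I" and eq: "edge (p, j) = edge (q, k)"
  note w = w_eqD[of p q j k] w_eqD[of p q j "Suc k"]
    w_eqD[of p q "Suc j" k] w_eqD[of p q "Suc j" "Suc k"]
  have "2 \<le> ms ! (p div 2)" "2 \<le> ms ! (q div 2)"
    using I by (auto simp: I_def intro!: two_le')
  moreover have "w p j = w q k \<and> w p (Suc j) = w q (Suc k) \<or> w p j = w q (Suc k) \<and> w p (Suc j) = w q k"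
    using eq by (auto simp: edge_def doubleton_eq_iff)
  ultimately show "p = q \<and> j = k"
    using I w unfolding I_def by auto
qed

lemma f_edge: "x \<in> I \<Longrightarrow> f (edge x) = h x"
  by (simp add: f_def inj_on_edge)

lemma card_E: "card E = M"
  using card_image[OF inj_on_edge] card_I by simp

lemma offset_Suc_le: "i < length ms \<Longrightarrow> offset i + ms ! i \<le> offset (length ms)"
  unfolding offset_def by (simp flip: sum.lessThan_Suc) (rule sum_mono2, auto)

lemma h_image: "{1..M} \<subseteq> h ` I"
proof
  fix y assume y: "y \<in> {1..M}"
  \<comment> \<open>The zero-based index of the complementary pair containing \<open>y\<close>: the
    smaller label of that pair, minus 1.\<close>
  define t where "t = (if y \<le> offset (length ms) then y else M + 1 - y) - 1"
  have "t < (\<Sum>k<length ms. ms ! k)"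
    using y by (auto simp: t_def M_def offset_def)
  from exists_block[OF this] obtain i j
    where ij: "i < length ms" "j < ms ! i" "t = offset i + j"
    by (auto simp: offset_def)
  have "y = t + 1 \<or> y = M + 1 - (t + 1)"
    using y by (auto simp: t_def)
  \<comment> \<open>Of the two twins in block \<open>i\<close>, the one whose parity agrees with
    \<open>j\<close> carries the small label at position \<open>j\<close>; the other one carries its
    complement.\<close>
  moreover have "t + 1 \<in> h ` I"
    using ij by (intro image_eqI[of _ _ "(2 * i + j mod 2, j)"])
      (auto simp: h_def I_def even_add)
  moreover have "M + 1 - (t + 1) \<in> h ` I"
    using ij by (intro image_eqI[of _ _ "(2 * i + Suc j mod 2, j)"])
      (auto simp: h_def I_def even_add)
  ultimately show "y \<in> h ` I"
    by auto
qed

text \<open>A map from the \<open>M\<close> indices that hits all of \<open>{1..M}\<close> has no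
  room for other values or for repetitions.\<close>

lemma bij_betw_h: "bij_betw h I {1..M}"
proof -
  have "card (h ` I) \<le> M"
    using card_image_le[OF finite_I, of h] card_I by simp
  then have "{1..M} = h ` I"
    using h_image finite_I by (intro card_seteq) auto
  then show ?thesis
    using eq_card_imp_inj_on[OF finite_I, of h] card_I
    by (metis bij_betw_def card_atLeastAtMost diff_Suc_1)
qed

lemma bij_betw_f: "bij_betw f E {1..card E}"
proof -
  have "bij_betw (h \<circ> inv_into I edge) E {1..M}"
    using inj_on_edge bij_betw_h
    by (intro bij_betw_trans[OF bij_betw_inv_into]) (auto simp: bij_betw_def)
  then show ?thesis
    by (simp add: card_E f_def[abs_def] comp_def)
qed

section \<open>Vertex sums\<close>

lemma vertex_sum_eq: "vertex_sum E f x = (\<Sum>y\<in>{y \<in> I. x \<in> edge y}. h y)"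
proof -
  have "{e \<in> E. x \<in> e} = edge ` {y \<in> I. x \<in> edge y}"
    by auto
  moreover have "inj_on edge {y \<in> I. x \<in> edge y}"
    using inj_on_edge by (rule inj_on_subset) auto
  ultimately show ?thesis
    by (simp add: vertex_sum_def sum.reindex f_edge)
qed

text \<open>Ensures that the natural-number subtraction in \<open>h\<close> never truncates.\<close>

lemma label_le:
  assumes "i < length ms" "j < ms ! i"
  shows "offset i + j + 1 \<le> M"
  using offset_Suc_le[OF assms(1)] assms(2) by (simp add: M_def)

text \<open>Exactly two edges meet here, with consecutive values \<open>t\<close> and
  \<open>t + 1\<close>, one of them complemented: \<open>t + (M + 1 - (t + 1))\<close> is
  \<open>M\<close>, and \<open>(M + 1 - t) + (t + 1)\<close> is \<open>M + 2\<close>.\<close>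

lemma vertex_sum_inner:
  assumes p: "p < 2 * length ms" and k: "Suc k < ms ! (p div 2)"
  shows "vertex_sum E f (w p (Suc k)) = (if even (p + k) then M else M + 2)"
proof -
  have "(q, j) \<in> I \<and> w p (Suc k) \<in> edge (q, j) \<longleftrightarrow> q = p \<and> (j = k \<or> j = Suc k)" for q j
  proof
    assume "(q, j) \<in> I \<and> w p (Suc k) \<in> edge (q, j)"
    then show "q = p \<and> (j = k \<or> j = Suc k)"
      using p k w_eqD[of p q "Suc k" j] w_eqD[of p q "Suc k" "Suc j"]
      by (auto simp: I_def edge_def)
  qed (use p k in \<open>auto simp: I_def edge_def\<close>)
  then have "{y \<in> I. w p (Suc k) \<in> edge y} = {(p, k), (p, Suc k)}"
    by auto
  then have "vertex_sum E f (w p (Suc k)) = h (p, k) + h (p, Suc k)"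
    by (simp add: vertex_sum_eq)
  moreover have "offset (p div 2) + Suc k + 1 \<le> M"
    using p k by (intro label_le) auto
  ultimately show ?thesis
    by (auto simp: h_def)
qed

lemma h_twins:
  assumes "i < length ms" "j < ms ! i"
  shows "h (2 * i, j) + h (2 * i + 1, j) = M + 1"
  using label_le[OF assms] by (auto simp: h_def)

text \<open>Serves both ends: with \<open>c i = 0\<close> the chosen edges are those at
  \<open>u\<close>, with \<open>c i = ms ! i - 1\<close> those at \<open>v\<close>.\<close>

lemma sum_over_twins:
  assumes "\<And>i. i < length ms \<Longrightarrow> c i < ms ! i"
  shows "(\<Sum>y\<in>(\<lambda>p. (p, c (p div 2))) ` {..<2 * length ms}. h y) = length ms * (M + 1)"
proof -
  have "(\<Sum>y\<in>(\<lambda>p. (p, c (p div 2))) ` {..<2 * length ms}. h y)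
      = (\<Sum>p<2 * length ms. h (p, c (p div 2)))"
    by (subst sum.reindex) (auto simp: inj_on_def)
  also have "\<dots> = (\<Sum>i<length ms. h (2 * i, c i) + h (2 * i + 1, c i))"
    by (simp add: sum_lessThan_double)
  also have "\<dots> = (\<Sum>i<length ms. M + 1)"
    using h_twins assms by (intro sum.cong) auto
  finally show ?thesis
    by simp
qed

lemma vertex_sum_first: "vertex_sum E f u = length ms * (M + 1)"
proof -
  have "(q, j) \<in> I \<and> u \<in> edge (q, j) \<longleftrightarrow> q < 2 * length ms \<and> j = 0" for q j
  proof
    assume "(q, j) \<in> I \<and> u \<in> edge (q, j)"
    then show "q < 2 * length ms \<and> j = 0"
      using w_eqD[of q q 0 j] w_eqD[of q q 0 "Suc j"] w_first[of q]
      by (auto simp: I_def edge_def)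
  next
    assume "q < 2 * length ms \<and> j = 0"
    then show "(q, j) \<in> I \<and> u \<in> edge (q, j)"
      using two_le'[of q] w_first[of q] by (auto simp: I_def edge_def)
  qed
  then have "{y \<in> I. u \<in> edge y} = (\<lambda>p. (p, 0)) ` {..<2 * length ms}"
    by auto
  moreover have "0 < ms ! i" if "i < length ms" for i
    using two_le[OF that] by simp
  ultimately show ?thesis
    using sum_over_twins[of "\<lambda>_. 0"] by (simp add: vertex_sum_eq)
qed

lemma vertex_sum_last: "vertex_sum E f v = length ms * (M + 1)"
proof -
  have "(q, j) \<in> I \<and> v \<in> edge (q, j) \<longleftrightarrow> q < 2 * length ms \<and> j = ms ! (q div 2) - 1" for q j
  proof
    assume "(q, j) \<in> I \<and> v \<in> edge (q, j)"
    then have q: "q < 2 * length ms" and j: "j < ms ! (q div 2)"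
      and "v = w q j \<or> v = w q (Suc j)"
      by (auto simp: I_def edge_def)
    \<comment> \<open>The end \<open>v\<close> has only one position on path \<open>q\<close>;
      \<open>j < ms ! (q div 2)\<close> then rules out the first alternative.\<close>
    then have "ms ! (q div 2) = j \<or> ms ! (q div 2) = Suc j"
      using w_eqD[OF q q order_refl, of j] w_eqD[OF q q order_refl, of "Suc j"] w_last[OF q]
      by fastforce
    with q j show "q < 2 * length ms \<and> j = ms ! (q div 2) - 1"
      by simp
  next
    assume "q < 2 * length ms \<and> j = ms ! (q div 2) - 1"
    then show "(q, j) \<in> I \<and> v \<in> edge (q, j)"
      using two_le'[of q] w_last[of q] by (auto simp: I_def edge_def)
  qed
  then have "{y \<in> I. v \<in> edge y} = (\<lambda>p. (p, ms ! (p div 2) - 1)) ` {..<2 * length ms}"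
    by auto
  moreover have "ms ! i - 1 < ms ! i" if "i < length ms" for i
    using two_le[OF that] by simp
  ultimately show ?thesis
    using sum_over_twins[of "\<lambda>i. ms ! i - 1"] by (simp add: vertex_sum_eq)
qed

text \<open>For inner vertices the parity test is reversed against \<open>vertex_sum_inner\<close>,
  since \<open>k\<close> is now the position of the vertex itself and not of its
  predecessor.\<close>

lemma vertex_sum_w:
  assumes "p < 2 * length ms" "k \<le> ms ! (p div 2)"
  shows "vertex_sum E f (w p k) =
    (if k = 0 \<or> k = ms ! (p div 2) then length ms * (M + 1) else if even (p + k) then M + 2 else M)"
proof (cases "k = 0 \<or> k = ms ! (p div 2)")
  case True
  then show ?thesis
    using w_first[of p] w_last[of p] vertex_sum_first vertex_sum_last assms by auto
next
  case False
  then obtain k' where "k = Suc k'"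
    using not0_implies_Suc by blast
  with False show ?thesis
    using vertex_sum_inner[of p k'] assms by auto
qed

section \<open>Distinct sums at adjacent vertices and the number of colors\<close>

lemma end_sum_neq: "length ms * (M + 1) \<noteq> M" "length ms * (M + 1) \<noteq> M + 2"
proof -
  have "0 < M"
    using offset_Suc_le[of 0] two_le[of 0] ms_nonempty by (simp add: M_def)
  moreover obtain n where "length ms = Suc n"
    using ms_nonempty by (cases ms) auto
  ultimately show "length ms * (M + 1) \<noteq> M" "length ms * (M + 1) \<noteq> M + 2"
    \<comment> \<open>One block gives \<open>M + 1\<close>, strictly between the two inner sums;
      with more blocks the sum is at least \<open>2 * (M + 1)\<close>, which exceeds
      \<open>M + 2\<close> because \<open>0 < M\<close>.\<close>
    by (cases n; simp)+
qed

text \<open>Two inner neighbors differ in parity, and an end differs from every inner vertex by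
  \<open>end_sum_neq\<close>. Both ends are never adjacent, as the paths have length at least
  2.\<close>

lemma vertex_sum_consecutive:
  assumes "(p, j) \<in> I"
  shows "vertex_sum E f (w p j) \<noteq> vertex_sum E f (w p (Suc j))"
  using assms end_sum_neq two_le'[of p] vertex_sum_w[of p j] vertex_sum_w[of p "Suc j"]
  by (auto simp: I_def split: if_splits)

lemma local_antimagic_f: "local_antimagic_labeling E f"
  unfolding local_antimagic_labeling_def
proof (intro conjI bij_betw_f allI impI)
  fix x y assume "{x, y} \<in> E"
  then obtain p j where "(p, j) \<in> I" "{x, y} = {w p j, w p (Suc j)}"
    by (auto simp: edge_def)
  then show "vertex_sum E f x \<noteq> vertex_sum E f y"
    using vertex_sum_consecutive[of p j] by (auto simp: doubleton_eq_iff)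
qed

lemma chi_la_le_3:
  assumes "\<And>x. x \<in> V \<Longrightarrow> \<exists>p<2 * length ms. \<exists>k\<le>ms ! (p div 2). x = w p k"
  shows "chi_la V E \<le> 3"
proof -
  have "vertex_sum E f ` V \<subseteq> {M, M + 2, length ms * (M + 1)}"
    using assms by (force simp: vertex_sum_w)
  then have "card (vertex_sum E f ` V) \<le> card {M, M + 2, length ms * (M + 1)}"
    by (intro card_mono) auto
  also have "\<dots> \<le> 3"
    by (simp add: card_insert_if)
  finally have "enat (color_number V E f) \<le> 3"
    by (simp add: color_number_def numeral_eq_enat)
  then show ?thesis
    unfolding chi_la_def using local_antimagic_f by (intro INF_lower2[of f]) auto
qed

end

section \<open>From bridge graphs to twin paths\<close>

theorem theorem3p1:
  fixes V :: "'a set" and E :: "'a set set" and ms :: "nat list"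
  assumes "length ms \<ge> 1"
    and "\<forall>m\<in>set ms. m \<ge> 1"
    and "bridge_graph V E (concat (map (replicate 2) ms))"
  shows "chi_la V E \<le> 3"
proof -
  let ?n = "2 * length ms"
  obtain u v ps where "u \<noteq> v" and len: "length ps = ?n"
    and path: "\<And>p. p < ?n \<Longrightarrow> is_path V E u v (ps ! p)"
    and len_path: "\<And>p. p < ?n \<Longrightarrow> length (ps ! p) = ms ! (p div 2) + 1"
    and disj: "\<And>p q. \<lbrakk>p < ?n; q < ?n; p \<noteq> q\<rbrakk> \<Longrightarrow> set (ps ! p) \<inter> set (ps ! q) = {u, v}"
    and edge_disj: "\<And>p q. \<lbrakk>p < ?n; q < ?n; p \<noteq> q\<rbrakk> \<Longrightarrow>
        path_edges (ps ! p) \<inter> path_edges (ps ! q) = {}"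
    and V: "V = {u, v} \<union> (\<Union>p\<in>set ps. set p)" and E: "E = (\<Union>p\<in>set ps. path_edges p)"
    using assms(3) unfolding bridge_graph_def length_concat_map_replicate
    by (auto simp: nth_concat_map_replicate)
  let ?w = "\<lambda>p k. ps ! p ! k"
  have first: "?w p 0 = u" if "p < ?n" for p
    using path[OF that] by (auto simp: is_path_def hd_conv_nth)
  have last: "?w p (ms ! (p div 2)) = v" if "p < ?n" for p
    using path[OF that] len_path[OF that] by (auto simp: is_path_def last_conv_nth)
  have dist: "k = k'" if "p < ?n" "k \<le> ms ! (p div 2)" "k' \<le> ms ! (p div 2)" "?w p k = ?w p k'"
    for p k k'
    using path[of p] len_path[of p] that by (auto simp: is_path_def nth_eq_iff_index_eq)
  have in_path: "?w p k \<in> set (ps ! p)" if "p < ?n" "k \<le> ms ! (p div 2)" for p k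
    using len_path[of p] that by auto
  interpret twin_paths ms ?w u v
  proof
    show "ms \<noteq> []"
      using assms(1) by auto
  next
    fix i assume i: "i < length ms"
    show "2 \<le> ms ! i"
    proof (rule ccontr)
      assume "\<not> 2 \<le> ms ! i"
      moreover have "1 \<le> ms ! i"
        using assms(2) i by auto
      ultimately have 1: "ms ! i = 1"
        by simp
      \<comment> \<open>Twins of length 1 would both consist of the edge \<open>{u, v}\<close>,
        against edge-disjointness.\<close>
      have "{u, v} \<in> path_edges (ps ! p)" if "p < ?n" "p div 2 = i" for p
        using that first[of p] last[of p] len_path[of p] 1
        by (auto simp: path_edges_def intro!: exI[of _ 0])
      from this[of "2 * i"] this[of "2 * i + 1"] edge_disj[of "2 * i" "2 * i + 1"]
      show False
        using i by auto
    qed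
  next
    fix p q k k'
    assume *: "p < ?n" "q < ?n" "k \<le> ms ! (p div 2)" "k' \<le> ms ! (q div 2)" "?w p k = ?w q k'"
    show "k = 0 \<and> k' = 0 \<or> k = ms ! (p div 2) \<and> k' = ms ! (q div 2) \<or> p = q \<and> k = k'"
    proof (cases "p = q")
      case True
      with * dist show ?thesis
        by blast
    next
      case False
      \<comment> \<open>Different paths share only their ends, and \<open>dist\<close> fixes the
        position of an end on each path.\<close>
      then have "?w p k \<in> {u, v}"
        using disj[of p q] in_path[of p k] in_path[of q k'] * by auto
      then show ?thesis
      proof (elim insertE emptyE)
        assume "?w p k = u"
        then show ?thesis
          using * first dist[of p k 0] dist[of q k' 0] by auto
      next
        assume "?w p k = v"
        then show ?thesis
          using * last dist[of p k "ms ! (p div 2)"] dist[of q k' "ms ! (q div 2)"] by auto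
      qed
    qed
  qed (use first last in auto)
  have "E = edge ` I"
  proof -
    have "path_edges (ps ! p) = (\<lambda>j. edge (p, j)) ` {..<ms ! (p div 2)}" if "p < ?n" for p
      using len_path[OF that] by (auto simp: path_edges_def edge_def)
    moreover have "E = (\<Union>p<?n. path_edges (ps ! p))"
      unfolding E by (auto simp: set_conv_nth len)
    ultimately show ?thesis
      by (auto simp: I_def)
  qed
  moreover have "\<exists>p<?n. \<exists>k\<le>ms ! (p div 2). x = ?w p k" if "x \<in> V" for x
  proof -
    \<comment> \<open>At least one path exists, and it covers \<open>u\<close> and
      \<open>v\<close>.\<close>
    have "0 < ?n"
      using assms(1) by (cases ms) auto
    then have "u \<in> set (ps ! 0)" "v \<in> set (ps ! 0)"
      using path[of 0] by (auto simp: is_path_def)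
    with that \<open>0 < ?n\<close> have "\<exists>p<?n. x \<in> set (ps ! p)"
      unfolding V len[symmetric] by (auto simp: in_set_conv_nth[of _ ps] intro: exI[of _ 0])
    then obtain p k where "p < ?n" "k < length (ps ! p)" "x = ?w p k"
      by (metis in_set_conv_nth)
    then show ?thesis
      using len_path[of p] by (intro exI[of _ p] conjI exI[of _ k]) auto
  qed
  ultimately show ?thesis
    using chi_la_le_3 by simp
qed

end
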